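(* Let the Finsler space $(M,F)$, $\dim M=N\ge3$, be conformally automorphic to the Riemannian space $(M,S)$ with constant degree $H$ through the transformation $t=t(x,y)$, and let $$N^k{}_m=-y^k_i\left(\frac{\partial t^i}{\partial x^m}+a^i{}_{hm}t^h\right),\qquad N^k{}_{mn}=\frac{\partial N^k{}_m}{\partial y^n}.$$ Then the covariant derivative of the Finsler metric tensor vanishes: $$\mathcal D_mg_{nj}:=d_mg_{nj}+N^k{}_{mj}\,g_{kn}+N^k{}_{mn}\,g_{kj}=0,\qquad d_m=\frac{\partial}{\partial x^m}+N^k{}_m\frac{\partial}{\partial y^k}.$$
   Context: $M$ is a $C^\infty$ manifold with local coordinates $x^i$; $y^i$ are the induced coordinates of tangent vectors $y\in T_xM\setminus0$; repeated indices are summed over $1,\dots,N$; considerations are local. The Finsler metric function $F(x,y)$ is smooth, positive, positively homogeneous of degree 1 in $y$, with positive-definite metric tensor $g_{ij}=\frac12\,\partial^2F^2/\partial y^i\partial y^j$. $S(x,y)=\sqrt{a_{ij}(x)y^iy^j}$ is a Riemannian metric function and $a^i{}_{kn}(x)$ are the Christoffel symbols of $a_{ij}$. Definition. $(M,F)$ is conformally automorphic to $(M,S)$, of degree $H>0$, if there is a smooth family of invertible smooth transformations $y\mapsto t=t(x,y)$ of nonzero tangent vectors at $x$ into nonzero tangent vectors at the same $x$ such that: (i) $t^m(x,ky)=k^{H}t^m(x,y)$ for all $k>0$; (ii) $F(x,y)=1\iff S(x,t(x,y))=1$; (iii) $g_{mn}(x,y)=p^2\,a_{ij}(x)\,t^i_m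 t^j_n$, where $t^i_m=\partial t^i/\partial y^m$ and $p=p(x,y)>0$. Notation: $y=y(x,t)$ is the inverse transformation and $y^k_i=\partial y^k/\partial t^i$, evaluated at $t=t(x,y)$. *)

theory Defs
  imports "HOL-Analysis.Analysis"
begin

text \<open>
  All considerations are local: an open set \<open>U\<close> of \<open>real^'n\<close> is the domain of a coordinate chart
  of \<open>M\<close>, tangent vectors are given by their components \<open>y :: real^'n\<close>, and \<open>N = CARD('n)\<close>.
  Functions on the slit tangent bundle are curried, \<open>f x y\<close>, and their values at
  \<open>y = 0\<close> are irrelevant. Tensors with two lower indices are matrices; other index objects are
  functions whose index arguments come in the order of the printed symbol, upper index first.
\<close>

subsection \<open>Smoothness and partial derivatives\<close>

text \<open>Only meant for open \<open>S\<close>, as derivatives are taken in the whole space.\<close>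

primrec k_smooth_on :: "nat \<Rightarrow> 'a::real_normed_vector set \<Rightarrow> ('a \<Rightarrow> 'b::real_normed_vector) \<Rightarrow> bool"
where
  "k_smooth_on 0 S f \<longleftrightarrow> continuous_on S f"
| "k_smooth_on (Suc k) S f \<longleftrightarrow>
     (\<forall>x\<in>S. f differentiable (at x)) \<and> (\<forall>v. k_smooth_on k S (\<lambda>x. frechet_derivative f (at x) v))"

definition smooth_on :: "'a::real_normed_vector set \<Rightarrow> ('a \<Rightarrow> 'b::real_normed_vector) \<Rightarrow> bool" where
  "smooth_on S f \<longleftrightarrow> (\<forall>k. k_smooth_on k S f)"

definition partial :: "'n::finite \<Rightarrow> (real^'n \<Rightarrow> real) \<Rightarrow> real^'n \<Rightarrow> real" where
  "partial i f x = deriv (\<lambda>s. f (x + s *\<^sub>R axis i 1)) 0"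

definition partial_x :: "'n::finite \<Rightarrow> (real^'n \<Rightarrow> real^'n \<Rightarrow> real) \<Rightarrow> real^'n \<Rightarrow> real^'n \<Rightarrow> real" where
  "partial_x i f x y = partial i (\<lambda>x'. f x' y) x"

definition partial_y :: "'n::finite \<Rightarrow> (real^'n \<Rightarrow> real^'n \<Rightarrow> real) \<Rightarrow> real^'n \<Rightarrow> real^'n \<Rightarrow> real" where
  "partial_y i f x y = partial i (f x) y"

definition slit :: "(real^'n::finite) set \<Rightarrow> ((real^'n) \<times> (real^'n)) set" where
  "slit U = U \<times> (UNIV - {0})"

subsection \<open>Finsler and Riemannian metrics\<close>

definition pos_def :: "real^'n::finite^'n \<Rightarrow> bool" where
  "pos_def A \<longleftrightarrow> (\<forall>v. v \<noteq> 0 \<longrightarrow> (\<Sum>i\<in>UNIV. \<Sum>j\<in>UNIV. A $ i $ j * v $ i * v $ j) > 0)"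

definition metric_tensor :: "(real^'n::finite \<Rightarrow> real^'n \<Rightarrow> real) \<Rightarrow> real^'n \<Rightarrow> real^'n \<Rightarrow> real^'n^'n" where
  "metric_tensor F x y =
     (\<chi> i j. 1 / 2 * partial_y i (partial_y j (\<lambda>x y. (F x y)\<^sup>2)) x y)"

definition finsler_metric :: "(real^'n::finite) set \<Rightarrow> (real^'n \<Rightarrow> real^'n \<Rightarrow> real) \<Rightarrow> bool" where
  "finsler_metric U F \<longleftrightarrow>
     smooth_on (slit U) (\<lambda>(x, y). F x y) \<and>
     (\<forall>x\<in>U. \<forall>y. y \<noteq> 0 \<longrightarrow>
        F x y > 0 \<and>
        (\<forall>k>0. F x (k *\<^sub>R y) = k * F x y) \<and>
        pos_def (metric_tensor F x y))"

definition riemannian_tensor :: "(real^'n::finite) set \<Rightarrow> (real^'n \<Rightarrow> real^'n^'n) \<Rightarrow> bool" where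
  "riemannian_tensor U a \<longleftrightarrow>
     smooth_on U a \<and> (\<forall>x\<in>U. transpose (a x) = a x \<and> pos_def (a x))"

definition riemannian_function :: "(real^'n::finite \<Rightarrow> real^'n^'n) \<Rightarrow> real^'n \<Rightarrow> real^'n \<Rightarrow> real" where
  "riemannian_function a x y = sqrt (\<Sum>i\<in>UNIV. \<Sum>j\<in>UNIV. a x $ i $ j * y $ i * y $ j)"

definition christoffel :: "(real^'n::finite \<Rightarrow> real^'n^'n) \<Rightarrow> real^'n \<Rightarrow> 'n \<Rightarrow> 'n \<Rightarrow> 'n \<Rightarrow> real" where
  "christoffel a x i k n =
     (\<Sum>h\<in>UNIV. 1 / 2 * matrix_inv (a x) $ i $ h *
        (partial k (\<lambda>x. a x $ h $ n) x + partial n (\<lambda>x. a x $ h $ k) x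
          - partial h (\<lambda>x. a x $ k $ n) x))"

subsection \<open>Conformal automorphisms\<close>

text \<open>
  Smoothness of the inverse transformations is not required separately: by the last condition
  and positive definiteness of the metric tensor, the Jacobian matrix of \<open>t x\<close> is
  nonsingular on nonzero vectors.
\<close>

definition conformally_automorphic_through ::
  "(real^'n::finite) set \<Rightarrow> (real^'n \<Rightarrow> real^'n \<Rightarrow> real) \<Rightarrow> (real^'n \<Rightarrow> real^'n^'n) \<Rightarrow> real
     \<Rightarrow> (real^'n \<Rightarrow> real^'n \<Rightarrow> real^'n) \<Rightarrow> bool" where
  "conformally_automorphic_through U F a H t \<longleftrightarrow>
     H > 0 \<and>
     smooth_on (slit U) (\<lambda>(x, y). t x y) \<and>
     (\<forall>x\<in>U. bij_betw (t x) (UNIV - {0}) (UNIV - {0})) \<and>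
     (\<forall>x\<in>U. \<forall>y. y \<noteq> 0 \<longrightarrow> (\<forall>k>0. t x (k *\<^sub>R y) = (k powr H) *\<^sub>R t x y)) \<and>
     (\<forall>x\<in>U. \<forall>y. y \<noteq> 0 \<longrightarrow> (F x y = 1 \<longleftrightarrow> riemannian_function a x (t x y) = 1)) \<and>
     (\<exists>p. \<forall>x\<in>U. \<forall>y. y \<noteq> 0 \<longrightarrow> p x y > 0 \<and>
        (\<forall>m n. metric_tensor F x y $ m $ n =
           (p x y)\<^sup>2 * (\<Sum>i\<in>UNIV. \<Sum>j\<in>UNIV. a x $ i $ j *
              partial_y m (\<lambda>x y. t x y $ i) x y * partial_y n (\<lambda>x y. t x y $ j) x y)))"

definition conformally_automorphic ::
  "(real^'n::finite) set \<Rightarrow> (real^'n \<Rightarrow> real^'n \<Rightarrow> real) \<Rightarrow> (real^'n \<Rightarrow> real^'n^'n) \<Rightarrow> real \<Rightarrow> bool" where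
  "conformally_automorphic U F a H \<longleftrightarrow> (\<exists>t. conformally_automorphic_through U F a H t)"

definition inverse_transformation ::
  "(real^'n::finite \<Rightarrow> real^'n \<Rightarrow> real^'n) \<Rightarrow> real^'n \<Rightarrow> real^'n \<Rightarrow> real^'n" where
  "inverse_transformation t x = inv_into (UNIV - {0}) (t x)"

subsection \<open>The nonlinear connection and the covariant derivative\<close>

definition connection_coeff ::
  "(real^'n::finite \<Rightarrow> real^'n^'n) \<Rightarrow> (real^'n \<Rightarrow> real^'n \<Rightarrow> real^'n)
     \<Rightarrow> 'n \<Rightarrow> 'n \<Rightarrow> real^'n \<Rightarrow> real^'n \<Rightarrow> real" where
  "connection_coeff a t k m x y =
     - (\<Sum>i\<in>UNIV. partial i (\<lambda>s. inverse_transformation t x s $ k) (t x y) *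
          (partial_x m (\<lambda>x y. t x y $ i) x y + (\<Sum>h\<in>UNIV. christoffel a x i h m * t x y $ h)))"

definition horizontal_deriv ::
  "('n::finite \<Rightarrow> 'n \<Rightarrow> real^'n \<Rightarrow> real^'n \<Rightarrow> real) \<Rightarrow> 'n
     \<Rightarrow> (real^'n \<Rightarrow> real^'n \<Rightarrow> real) \<Rightarrow> real^'n \<Rightarrow> real^'n \<Rightarrow> real" where
  "horizontal_deriv N m f x y = partial_x m f x y + (\<Sum>k\<in>UNIV. N k m x y * partial_y k f x y)"

definition covariant_deriv ::
  "('n::finite \<Rightarrow> 'n \<Rightarrow> real^'n \<Rightarrow> real^'n \<Rightarrow> real) \<Rightarrow> 'n
     \<Rightarrow> (real^'n \<Rightarrow> real^'n \<Rightarrow> real^'n^'n) \<Rightarrow> 'n \<Rightarrow> 'n \<Rightarrow> real^'n \<Rightarrow> real^'n \<Rightarrow> real" where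
  "covariant_deriv N m g n j x y =
     horizontal_deriv N m (\<lambda>x y. g x y $ n $ j) x y
     + (\<Sum>k\<in>UNIV. partial_y j (N k m) x y * g x y $ k $ n)
     + (\<Sum>k\<in>UNIV. partial_y n (N k m) x y * g x y $ k $ j)"

end

theory Submission
  imports Defs
begin

text \<open>
  Write \<open>b = a\<^sub>i\<^sub>j t\<^sup>i t\<^sup>j\<close>. Homogeneity and the correspondence of the indicatrices give
  \<open>b = F\<^bsup>2H\<^esup>\<close>; contracting the conformal relation twice with \<open>y\<close> and using Euler's theorem for
  \<open>F\<^sup>2\<close> and \<open>t\<close> shows that the conformal factor is \<open>p\<^sup>2 = b\<^bsup>1/H - 1\<^esup> / H\<^sup>2\<close>, a function of \<open>b\<close> alone.
  The connection is made so that \<open>d\<^sub>m t\<^sup>i = - a\<^sup>i\<^sub>h\<^sub>m t\<^sup>h\<close>. Hence \<open>d\<^sub>m b = 0\<close> by metric compatibility of the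
  Christoffel symbols, and \<open>d\<^sub>m p = 0\<close>. Differentiating in \<open>y\<^sup>n\<close> and exchanging the second derivatives
  of \<open>t\<close> gives \<open>d\<^sub>m t\<^sup>i\<^sub>n = - a\<^sup>i\<^sub>h\<^sub>m t\<^sup>h\<^sub>n - N\<^sup>k\<^sub>m\<^sub>n t\<^sup>i\<^sub>k\<close>, and the product rule for
  \<open>g\<^sub>n\<^sub>j = p\<^sup>2 a\<^sub>i\<^sub>h t\<^sup>i\<^sub>n t\<^sup>h\<^sub>j\<close> together with metric compatibility finishes the proof.
\<close>

subsection \<open>Symmetry of second derivatives\<close>

text \<open>The mean value theorem is applied twice: in \<open>r\<close> to the increment of
  \<open>f\<close> along \<open>w\<close>, then in \<open>s\<close> to \<open>fv\<close>.
  Derivatives are required only along the grid lines of the parallelogram spanned by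
  \<open>h v\<close> and \<open>h w\<close>.\<close>

lemma second_difference_mvt:
  fixes f :: "'a::real_normed_vector \<Rightarrow> real"
  assumes "h > 0"
    and fv: "\<And>r s. \<lbrakk>0 \<le> r; r \<le> h; 0 \<le> s; s \<le> h\<rbrakk> \<Longrightarrow>
      ((\<lambda>r. f (z + r *\<^sub>R v + s *\<^sub>R w)) has_real_derivative fv (z + r *\<^sub>R v + s *\<^sub>R w)) (at r)"
    and fvw: "\<And>r s. \<lbrakk>0 \<le> r; r \<le> h; 0 \<le> s; s \<le> h\<rbrakk> \<Longrightarrow>
      ((\<lambda>s. fv (z + r *\<^sub>R v + s *\<^sub>R w)) has_real_derivative fvw (z + r *\<^sub>R v + s *\<^sub>R w)) (at s)"
  obtains r s where "0 < r" "r < h" "0 < s" "s < h"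
    "f (z + h *\<^sub>R v + h *\<^sub>R w) - f (z + h *\<^sub>R v) - f (z + h *\<^sub>R w) + f z
       = h\<^sup>2 * fvw (z + r *\<^sub>R v + s *\<^sub>R w)"
proof -
  \<comment> \<open>The summand \<open>0 *\<^sub>R w\<close> is kept so that both terms match the
    hypothesis \<open>fv\<close>, with \<open>s = h\<close> and \<open>s = 0\<close>.\<close>
  let ?\<phi> = "\<lambda>r. f (z + r *\<^sub>R v + h *\<^sub>R w) - f (z + r *\<^sub>R v + 0 *\<^sub>R w)"
  have "\<exists>r>0. r < h \<and> ?\<phi> h - ?\<phi> 0
      = (h - 0) * (fv (z + r *\<^sub>R v + h *\<^sub>R w) - fv (z + r *\<^sub>R v + 0 *\<^sub>R w))"
    using \<open>h > 0\<close> by (intro MVT2 DERIV_diff fv) auto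
  then obtain r where r: "0 < r" "r < h"
    and 1: "?\<phi> h - ?\<phi> 0 = h * (fv (z + r *\<^sub>R v + h *\<^sub>R w) - fv (z + r *\<^sub>R v + 0 *\<^sub>R w))"
    by auto
  have "\<exists>s>0. s < h \<and> fv (z + r *\<^sub>R v + h *\<^sub>R w) - fv (z + r *\<^sub>R v + 0 *\<^sub>R w)
      = (h - 0) * fvw (z + r *\<^sub>R v + s *\<^sub>R w)"
    using \<open>h > 0\<close> r by (intro MVT2 fvw) auto
  then obtain s where s: "0 < s" "s < h"
    and 2: "fv (z + r *\<^sub>R v + h *\<^sub>R w) - fv (z + r *\<^sub>R v + 0 *\<^sub>R w) = h * fvw (z + r *\<^sub>R v + s *\<^sub>R w)"
    by auto
  from 1 2 have "f (z + h *\<^sub>R v + h *\<^sub>R w) - f (z + h *\<^sub>R v) - f (z + h *\<^sub>R w) + f z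
       = h\<^sup>2 * fvw (z + r *\<^sub>R v + s *\<^sub>R w)"
    by (simp add: power2_eq_square algebra_simps)
  with r s show thesis using that by blast
qed

lemma has_derivative_imp_line:
  fixes f :: "'a::real_normed_vector \<Rightarrow> real"
  assumes "(f has_derivative D) (at (p + r *\<^sub>R v))"
  shows "((\<lambda>r. f (p + r *\<^sub>R v)) has_real_derivative D v) (at r)"
proof -
  have "((\<lambda>r. f (p + r *\<^sub>R v)) has_derivative (\<lambda>h. D (h *\<^sub>R v))) (at r)"
    by (rule has_derivative_compose[where f = "\<lambda>r. p + r *\<^sub>R v", OF _ assms])
       (auto intro!: derivative_eq_intros)
  moreover have "(\<lambda>h. D (h *\<^sub>R v)) = (*) (D v)"
    using has_derivative_linear[OF assms] by (simp add: linear_cmul fun_eq_iff)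
  ultimately show ?thesis by (simp add: has_field_derivative_def)
qed

text \<open>The second difference of \<open>f\<close> is symmetric in \<open>v\<close> and
  \<open>w\<close>, so the two mixed derivatives agree at a pair of points arbitrarily close to
  \<open>z\<close>. If they differed at \<open>z\<close>, continuity would keep them apart near
  \<open>z\<close>.\<close>

lemma mixed_derivatives_eq_real:
  fixes f :: "'a::real_normed_vector \<Rightarrow> real"
  assumes S: "open S" "z \<in> S"
    and f: "\<And>p. p \<in> S \<Longrightarrow> (f has_derivative D p) (at p)"
    and Dv: "\<And>p. p \<in> S \<Longrightarrow> ((\<lambda>p. D p v) has_derivative Dv p) (at p)"
    and Dw: "\<And>p. p \<in> S \<Longrightarrow> ((\<lambda>p. D p w) has_derivative Dw p) (at p)"
    and cont: "continuous_on S (\<lambda>p. Dv p w)" "continuous_on S (\<lambda>p. Dw p v)"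
  shows "Dv z w = Dw z v"
proof (rule ccontr)
  assume ne: "Dv z w \<noteq> Dw z v"
  \<comment> \<open>Half the gap: numbers strictly within \<open>e\<close> of the two different
    values cannot coincide.\<close>
  define e where "e = \<bar>Dv z w - Dw z v\<bar> / 2"
  have "e > 0" using ne by (simp add: e_def)
  have "isCont (\<lambda>p. Dv p w) z" "isCont (\<lambda>p. Dw p v) z"
    using cont S by (auto simp: continuous_on_eq_continuous_at)
  then have "eventually (\<lambda>p. dist (Dv p w) (Dv z w) < e) (nhds z)"
    "eventually (\<lambda>p. dist (Dw p v) (Dw z v) < e) (nhds z)"
    using tendsto_at_iff_tendsto_nhds[of "\<lambda>p. Dv p w" z] tendsto_at_iff_tendsto_nhds[of "\<lambda>p. Dw p v" z]
    by (simp_all add: isCont_def tendstoD[OF _ \<open>e > 0\<close>])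
  moreover have "eventually (\<lambda>p. p \<in> S) (nhds z)"
    using S by (rule eventually_nhds_in_open)
  ultimately have "eventually (\<lambda>p. p \<in> S \<and> dist (Dv p w) (Dv z w) < e \<and> dist (Dw p v) (Dw z v) < e) (nhds z)"
    by eventually_elim auto
  then obtain d where "d > 0"
    and d: "\<And>p. dist p z < d \<Longrightarrow> p \<in> S \<and> dist (Dv p w) (Dv z w) < e \<and> dist (Dw p v) (Dw z v) < e"
    by (auto simp: eventually_nhds_metric)
  \<comment> \<open>This side length keeps the whole parallelogram inside the ball of radius
    \<open>d\<close>; the 1 makes the denominator positive even for
    \<open>v = w = 0\<close>.\<close>
  define h where "h = d / (norm v + norm w + 1)"
  have pos: "norm v + norm w + 1 > 0" by (smt (verit) norm_ge_zero)
  have "h > 0" using \<open>d > 0\<close> pos by (simp add: h_def)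
  have near: "dist (z + r *\<^sub>R v + s *\<^sub>R w) z < d" if "0 \<le> r" "r \<le> h" "0 \<le> s" "s \<le> h" for r s
  proof -
    have "dist (z + r *\<^sub>R v + s *\<^sub>R w) z = norm (r *\<^sub>R v + s *\<^sub>R w)"
      by (simp add: dist_norm algebra_simps)
    also have "\<dots> \<le> r * norm v + s * norm w"
      using norm_triangle_ineq[of "r *\<^sub>R v" "s *\<^sub>R w"] that by simp
    also have "\<dots> \<le> h * norm v + h * norm w"
      using that by (intro add_mono mult_right_mono) auto
    also have "\<dots> < h * (norm v + norm w + 1)"
      using \<open>h > 0\<close> by (simp add: algebra_simps)
    also have "\<dots> = d" using pos by (simp add: h_def)
    finally show ?thesis .
  qed
  have near': "dist (z + r *\<^sub>R w + s *\<^sub>R v) z < d" if "0 \<le> r" "r \<le> h" "0 \<le> s" "s \<le> h" for r s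
    using near[of s r] that by (simp add: add_ac)
  \<comment> \<open>\<open>has_derivative_imp_line\<close> varies the last summand, so
    differentiation in \<open>r\<close> needs the summands in the other order.\<close>
  have swap: "p + r *\<^sub>R v + s *\<^sub>R w = p + s *\<^sub>R w + r *\<^sub>R v" for p r s and v w :: 'a
    by (simp add: add_ac)
  obtain r s where rs: "0 < r" "r < h" "0 < s" "s < h" and
    1: "f (z + h *\<^sub>R v + h *\<^sub>R w) - f (z + h *\<^sub>R v) - f (z + h *\<^sub>R w) + f z
        = h\<^sup>2 * Dv (z + r *\<^sub>R v + s *\<^sub>R w) w"
  proof (rule second_difference_mvt[of h f z v w "\<lambda>p. D p v" "\<lambda>p. Dv p w"])
    fix r s assume "0 \<le> r" "r \<le> h" "0 \<le> s" "s \<le> h"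
    then have p: "z + r *\<^sub>R v + s *\<^sub>R w \<in> S" using near d by blast
    then have p': "z + s *\<^sub>R w + r *\<^sub>R v \<in> S" by (simp only: swap)
    from has_derivative_imp_line[OF f[OF p']]
    show "((\<lambda>r. f (z + r *\<^sub>R v + s *\<^sub>R w)) has_real_derivative D (z + r *\<^sub>R v + s *\<^sub>R w) v) (at r)"
      by (simp only: swap[of z _ w _ v])
    from has_derivative_imp_line[OF Dv[OF p]]
    show "((\<lambda>s. D (z + r *\<^sub>R v + s *\<^sub>R w) v) has_real_derivative Dv (z + r *\<^sub>R v + s *\<^sub>R w) w) (at s)" .
  qed (use \<open>h > 0\<close> in auto)
  obtain r' s' where rs': "0 < r'" "r' < h" "0 < s'" "s' < h" and
    2: "f (z + h *\<^sub>R w + h *\<^sub>R v) - f (z + h *\<^sub>R w) - f (z + h *\<^sub>R v) + f z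
        = h\<^sup>2 * Dw (z + r' *\<^sub>R w + s' *\<^sub>R v) v"
  proof (rule second_difference_mvt[of h f z w v "\<lambda>p. D p w" "\<lambda>p. Dw p v"])
    fix r s assume "0 \<le> r" "r \<le> h" "0 \<le> s" "s \<le> h"
    then have p: "z + r *\<^sub>R w + s *\<^sub>R v \<in> S" using near' d by blast
    then have p': "z + s *\<^sub>R v + r *\<^sub>R w \<in> S" by (simp only: swap)
    from has_derivative_imp_line[OF f[OF p']]
    show "((\<lambda>r. f (z + r *\<^sub>R w + s *\<^sub>R v)) has_real_derivative D (z + r *\<^sub>R w + s *\<^sub>R v) w) (at r)"
      by (simp only: swap[of z _ v _ w])
    from has_derivative_imp_line[OF Dw[OF p]]
    show "((\<lambda>s. D (z + r *\<^sub>R w + s *\<^sub>R v) w) has_real_derivative Dw (z + r *\<^sub>R w + s *\<^sub>R v) v) (at s)" .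
  qed (use \<open>h > 0\<close> in auto)
  have "h\<^sup>2 * Dv (z + r *\<^sub>R v + s *\<^sub>R w) w = h\<^sup>2 * Dw (z + r' *\<^sub>R w + s' *\<^sub>R v) v"
    using 1 2 unfolding swap[of z h v h w] by linarith
  then have "Dv (z + r *\<^sub>R v + s *\<^sub>R w) w = Dw (z + r' *\<^sub>R w + s' *\<^sub>R v) v"
    using \<open>h > 0\<close> by simp
  moreover have "dist (Dv (z + r *\<^sub>R v + s *\<^sub>R w) w) (Dv z w) < e"
    using d near rs by force
  moreover have "dist (Dw (z + r' *\<^sub>R w + s' *\<^sub>R v) v) (Dw z v) < e"
    using d near' rs' by force
  ultimately show False
    unfolding e_def dist_real_def by argo
qed

subsection \<open>Smooth functions and partial derivatives\<close>

lemma smooth_on_has_derivative: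
  assumes "smooth_on S f" "x \<in> S"
  shows "(f has_derivative frechet_derivative f (at x)) (at x)"
proof -
  have "k_smooth_on (Suc 0) S f" using assms by (simp only: smooth_on_def)
  with assms show ?thesis by (simp add: frechet_derivative_works)
qed

lemma smooth_on_frechet_derivative:
  assumes "smooth_on S f"
  shows "smooth_on S (\<lambda>x. frechet_derivative f (at x) v)"
  unfolding smooth_on_def
proof
  fix k
  have "k_smooth_on (Suc k) S f" using assms by (simp only: smooth_on_def)
  then show "k_smooth_on k S (\<lambda>x. frechet_derivative f (at x) v)" by simp
qed

lemma smooth_on_continuous_on: "smooth_on S f \<Longrightarrow> continuous_on S f"
  unfolding smooth_on_def by (metis k_smooth_on.simps(1))

text \<open>Pairing with an arbitrary vector \<open>b\<close> reduces the claim to real-valued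
  functions; vectors with equal inner products against every \<open>b\<close> are equal.\<close>

lemma smooth_on_mixed_derivatives_eq:
  fixes f :: "'a::real_normed_vector \<Rightarrow> 'b::real_inner"
  assumes S: "open S" "z \<in> S" and f: "smooth_on S f"
  shows "frechet_derivative (\<lambda>p. frechet_derivative f (at p) v) (at z) w
       = frechet_derivative (\<lambda>p. frechet_derivative f (at p) w) (at z) v"
proof -
  let ?D = "\<lambda>v p. frechet_derivative f (at p) v"
  have "frechet_derivative (?D v) (at z) w \<bullet> b = frechet_derivative (?D w) (at z) v \<bullet> b" for b
  proof (rule mixed_derivatives_eq_real[OF S, of "\<lambda>p. f p \<bullet> b" "\<lambda>p v. ?D v p \<bullet> b"
      v "\<lambda>p w. frechet_derivative (?D v) (at p) w \<bullet> b" w "\<lambda>p v. frechet_derivative (?D w) (at p) v \<bullet> b"])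
    fix p assume "p \<in> S"
    show "((\<lambda>p. f p \<bullet> b) has_derivative (\<lambda>v. ?D v p \<bullet> b)) (at p)"
      by (intro has_derivative_inner_left smooth_on_has_derivative[OF f] \<open>p \<in> S\<close>)
    show "((\<lambda>p. ?D v p \<bullet> b) has_derivative (\<lambda>w. frechet_derivative (?D v) (at p) w \<bullet> b)) (at p)" for v
      by (intro has_derivative_inner_left smooth_on_has_derivative[OF smooth_on_frechet_derivative[OF f]]
          \<open>p \<in> S\<close>)
    then show "((\<lambda>p. ?D w p \<bullet> b) has_derivative (\<lambda>v. frechet_derivative (?D w) (at p) v \<bullet> b)) (at p)" .
  qed (intro continuous_intros smooth_on_continuous_on smooth_on_frechet_derivative f)+
  then show ?thesis by (metis vector_eq_rdot)
qed

lemma bounded_bilinear_matrix_vector_mult: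
  "bounded_bilinear ((*v) :: real^'n^'m \<Rightarrow> real^'n \<Rightarrow> real^'m)"
  by (intro bilinear_conv_bounded_bilinear[THEN iffD1])
     (auto simp: bilinear_def intro!: linearI
        simp: matrix_vector_mult_add_rdistrib matrix_vector_right_distrib
          matrix_vector_mult_scaleR scaleR_matrix_vector_assoc)

section \<open>Coordinate derivatives as values of the Frechet derivative\<close>

lemma partial_eq:
  assumes "(f has_derivative D) (at x)"
  shows "partial i f x = D (axis i 1)"
  unfolding partial_def
  using has_derivative_imp_line[of f D x 0 "axis i 1"] assms by (intro DERIV_imp_deriv) simp

lemma partial_x_eq:
  assumes "((\<lambda>z. f (fst z) (snd z)) has_derivative D) (at (x, y))"
  shows "partial_x i f x y = D (axis i 1, 0)"
  unfolding partial_x_def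
proof (rule partial_eq)
  have "((\<lambda>x. (x, y)) has_derivative (\<lambda>v. (v, 0))) (at x)"
    by (auto intro!: derivative_eq_intros)
  from has_derivative_compose[OF this assms]
  show "((\<lambda>x. f x y) has_derivative (\<lambda>v. D (v, 0))) (at x)" by simp
qed

lemma has_derivative_partial_snd:
  assumes "((\<lambda>z. f (fst z) (snd z)) has_derivative D) (at (x, y))"
  shows "(f x has_derivative (\<lambda>v. D (0, v))) (at y)"
proof -
  have "((\<lambda>y. (x, y)) has_derivative (\<lambda>v. (0, v))) (at y)"
    by (auto intro!: derivative_eq_intros)
  from has_derivative_compose[OF this assms] show ?thesis by simp
qed

lemma partial_y_eq:
  assumes "((\<lambda>z. f (fst z) (snd z)) has_derivative D) (at (x, y))"
  shows "partial_y i f x y = D (0, axis i 1)"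
  unfolding partial_y_def by (rule partial_eq[OF has_derivative_partial_snd[OF assms]])

text \<open>Turns a sum over a repeated index into one evaluation of a linear map; most contractions
  below pass through it.\<close>

lemma linear_axis_sum:
  fixes L :: "real^'n::finite \<Rightarrow> 'b::real_vector"
  assumes "linear L"
  shows "(\<Sum>k\<in>UNIV. v $ k *\<^sub>R L (axis k 1)) = L v"
proof -
  have "L v = L (\<Sum>k\<in>UNIV. v $ k *\<^sub>R axis k 1)"
    using basis_expansion[of v] by (simp add: scalar_mult_eq_scaleR)
  also have "\<dots> = (\<Sum>k\<in>UNIV. v $ k *\<^sub>R L (axis k 1))"
    by (simp add: linear_sum[OF assms] linear_cmul[OF assms])
  finally show ?thesis ..
qed

text \<open>The operator d_m is the directional derivative along the vector with x-part e_m and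
  y-part \<open>N k m\<close>, so the rules for Frechet derivatives apply to it directly.\<close>

lemma horizontal_deriv_eq:
  assumes "((\<lambda>z. f (fst z) (snd z)) has_derivative D) (at (x, y))"
  shows "horizontal_deriv N m f x y = D (axis m 1, \<chi> k. N k m x y)"
proof -
  let ?v = "\<chi> k. N k m x y"
  have lin: "linear D" using assms by (rule has_derivative_linear)
  have "linear (\<lambda>v. D (0, v))"
    using has_derivative_partial_snd[OF assms] by (rule has_derivative_linear)
  then have "(\<Sum>k\<in>UNIV. ?v $ k *\<^sub>R D (0, axis k 1)) = D (0, ?v)"
    by (rule linear_axis_sum)
  moreover have "D (axis m 1, ?v) = D (axis m 1, 0) + D (0, ?v)"
    using linear_add[OF lin, of "(axis m 1, 0)" "(0, ?v)"] by simp
  ultimately show ?thesis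
    by (simp add: horizontal_deriv_def partial_x_eq[OF assms] partial_y_eq[OF assms])
qed

subsection \<open>Linear algebra\<close>

lemma differentiable_det:
  fixes A :: "'a::real_normed_vector \<Rightarrow> real^'n^'n"
  assumes "\<And>i j. (\<lambda>s. A s $ i $ j) differentiable (at x within S)"
  shows "(\<lambda>s. det (A s)) differentiable (at x within S)"
proof -
  have prod: "(\<lambda>s. \<Prod>i\<in>I. A s $ i $ p i) differentiable (at x within S)" if "finite I" for I and p :: "'n \<Rightarrow> 'n"
    using that by (induction I) (auto intro!: differentiable_mult assms)
  show ?thesis
    unfolding det_def
    by (intro differentiable_sum ballI differentiable_mult differentiable_const prod) (auto simp: finite_permutations)
qed

text \<open>By Cramer's rule each component of the solution is a quotient of determinants, with
  column \<open>k\<close> replaced by \<open>b\<close> in the numerator. It will give the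
  differentiability of the connection coefficients in y without differentiating the inverse
  transformation twice.\<close>

lemma differentiable_linear_system:
  fixes A :: "'a::real_normed_vector \<Rightarrow> real^'n^'n"
  assumes A: "\<And>i j. (\<lambda>s. A s $ i $ j) differentiable (at s0)"
    and b: "\<And>i. (\<lambda>s. b s $ i) differentiable (at s0)"
    and S: "open S" "s0 \<in> S" and nz: "\<And>s. s \<in> S \<Longrightarrow> det (A s) \<noteq> 0"
    and sol: "\<And>s. s \<in> S \<Longrightarrow> A s *v u s = b s"
  shows "(\<lambda>s. u s $ k) differentiable (at s0)"
proof -
  let ?q = "\<lambda>s. det (\<chi> i j. if j = k then b s $ i else A s $ i $ j) / det (A s)"
  have "?q differentiable (at s0)"
  proof (intro differentiable_divide differentiable_det A nz S)
    show "(\<lambda>s. (\<chi> i j. if j = k then b s $ i else A s $ i $ j) $ i $ j) differentiable (at s0)" for i j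
      by (cases "j = k") (simp_all add: A b)
  qed
  moreover have "?q s = u s $ k" if "s \<in> S" for s
    using iffD1[OF cramer[OF nz[OF that]] sol[OF that]]
    by (metis (mono_tags, lifting) vec_lambda_beta)
  ultimately show ?thesis
    unfolding differentiable_def
    using has_derivative_transform_within_open[where s = S and f = ?q and g = "\<lambda>s. u s $ k", OF _ S] by blast
qed

subsection \<open>Metric compatibility of the Christoffel symbols\<close>

text \<open>The direction index \<open>m\<close> is fixed, so that contracting the remaining lower
  index with a vector is a matrix-vector product.\<close>

definition christoffel_matrix :: "(real^'n::finite \<Rightarrow> real^'n^'n) \<Rightarrow> real^'n \<Rightarrow> 'n \<Rightarrow> real^'n^'n" where
  "christoffel_matrix a x m = (\<chi> i h. christoffel a x i h m)"

lemma quadratic_form_eq_inner: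
  "(\<Sum>i\<in>UNIV. \<Sum>j\<in>UNIV. A $ i $ j * u $ i * v $ j) = u \<bullet> (A *v v)" for A :: "real^'n::finite^'n"
  by (simp add: inner_vec_def matrix_vector_mult_def sum_distrib_left mult_ac)

lemma pos_def_iff_inner: "pos_def A \<longleftrightarrow> (\<forall>v. v \<noteq> 0 \<longrightarrow> v \<bullet> (A *v v) > 0)"
  by (simp add: pos_def_def quadratic_form_eq_inner)

lemma pos_def_matrix_inv_right:
  assumes "pos_def A" shows "A ** matrix_inv A = mat 1"
proof -
  have "\<forall>v. A *v v = 0 \<longrightarrow> v = 0"
    using assms by (force simp: pos_def_iff_inner)
  then have "\<exists>B. B ** A = mat 1" by (simp add: matrix_left_invertible_ker)
  then have "\<exists>B. A ** B = mat 1 \<and> B ** A = mat 1" by (metis matrix_left_right_inverse)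
  then show ?thesis unfolding matrix_inv_def by (rule someI2_ex) auto
qed

lemma symmetric_matrix_inner:
  fixes A :: "real^'n^'n"
  assumes "transpose A = A"
  shows "u \<bullet> (A *v v) = (A *v u) \<bullet> v"
  by (metis assms dot_lmul_matrix vector_transpose_matrix)

text \<open>Lowering the upper index gives the Christoffel symbols of the first kind, the matrix
  \<open>?M\<close>. Two of its three terms are antisymmetric in the row and column index, so
  \<open>?M\<close> plus its transpose is the derivative of \<open>a\<close> along e_m.\<close>

lemma christoffel_metric_compatible:
  assumes U: "open U" "x \<in> U" and a: "riemannian_tensor U a" and D: "(a has_derivative D) (at x)"
  shows "u \<bullet> (D (axis m 1) *v v)
    = (christoffel_matrix a x m *v u) \<bullet> (a x *v v) + u \<bullet> (a x *v (christoffel_matrix a x m *v v))"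
proof -
  let ?G = "christoffel_matrix a x m"
  let ?M = "a x ** ?G"
  have sym: "transpose (a x') = a x'" if "x' \<in> U" for x'
    using a that by (simp add: riemannian_tensor_def)
  have Dij: "((\<lambda>x. a x $ i $ j) has_derivative (\<lambda>v. D v $ i $ j)) (at x)" for i j
    by (intro bounded_linear.has_derivative[OF bounded_linear_vec_nth] D)
  \<comment> \<open>Symmetry of \<open>a\<close> holds on the whole open set \<open>U\<close>, hence
    passes to the derivative.\<close>
  have "((\<lambda>x. a x $ i $ j) has_derivative (\<lambda>v. D v $ j $ i)) (at x)" for i j
    using Dij[of j i] U
  proof (rule has_derivative_transform_within_open)
    fix x' assume "x' \<in> U"
    then have "transpose (a x') $ i $ j = a x' $ i $ j" by (simp only: sym)
    then show "a x' $ j $ i = a x' $ i $ j" by (simp add: transpose_def)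
  qed
  from fun_cong[OF has_derivative_unique[OF this Dij]]
  have Dsym: "D v $ j $ i = D v $ i $ j" for v i j .
  have partial: "partial k (\<lambda>x. a x $ i $ j) x = D (axis k 1) $ i $ j" for k i j
    by (rule partial_eq[OF Dij])
  have M: "?M $ l $ k = 1 / 2 * (D (axis k 1) $ l $ m + D (axis m 1) $ l $ k - D (axis l 1) $ k $ m)" for l k
  proof -
    let ?c = "\<chi> h. 1 / 2 * (D (axis k 1) $ h $ m + D (axis m 1) $ h $ k - D (axis h 1) $ k $ m)"
    \<comment> \<open>The Christoffel symbols carry the inverse of \<open>a x\<close> as left
      factor; multiplying by \<open>a x\<close> cancels it.\<close>
    have "column k ?G = matrix_inv (a x) *v ?c"
      by (simp add: vec_eq_iff column_def christoffel_matrix_def christoffel_def partial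
          matrix_vector_mult_def mult_ac)
    then have "a x *v column k ?G = ?c"
      using pos_def_matrix_inv_right[of "a x"] a U
      by (simp add: matrix_vector_mul_assoc riemannian_tensor_def)
    then have "(a x *v column k ?G) $ l = ?c $ l" by simp
    then show ?thesis
      by (simp add: matrix_vector_mult_def matrix_matrix_mult_def column_def)
  qed
  have "D (axis m 1) = transpose ?M + ?M"
    by (simp add: vec_eq_iff transpose_def M Dsym[of _ m] field_simps) (metis Dsym)
  then have "u \<bullet> (D (axis m 1) *v v) = u \<bullet> (transpose ?M *v v) + u \<bullet> (?M *v v)"
    by (simp add: matrix_vector_mult_add_rdistrib inner_add_right)
  also have "u \<bullet> (transpose ?M *v v) = (?M *v u) \<bullet> v"
    by (metis dot_lmul_matrix inner_commute vector_transpose_matrix)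
  also have "\<dots> = (?G *v u) \<bullet> (a x *v v)"
    using symmetric_matrix_inner[OF sym[OF U(2)], of "?G *v u" v] by (simp add: matrix_vector_mul_assoc)
  finally show ?thesis by (simp add: matrix_vector_mul_assoc)
qed

text \<open>The product rule for a_ij u^i v^j, used below for b and for the factor a_ih t^i_n t^h_j
  of the metric tensor.\<close>

lemma has_derivative_inner_matrix:
  fixes u v :: "'a::real_normed_vector \<Rightarrow> real^'n" and A :: "'a \<Rightarrow> real^'n^'n"
  assumes "(u has_derivative u') (at z)" "(A has_derivative A') (at z)" "(v has_derivative v') (at z)"
  shows "((\<lambda>z. u z \<bullet> (A z *v v z)) has_derivative
     (\<lambda>h. u' h \<bullet> (A z *v v z) + u z \<bullet> (A' h *v v z) + u z \<bullet> (A z *v v' h))) (at z)"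
  by (rule derivative_eq_intros assms bounded_bilinear.FDERIV[OF bounded_bilinear_matrix_vector_mult])+
     (simp add: inner_add_right add_ac)

subsection \<open>The conformal factor\<close>

locale conformal_automorphism =
  fixes U :: "(real^'n::finite) set"
    and F :: "real^'n \<Rightarrow> real^'n \<Rightarrow> real"
    and a :: "real^'n \<Rightarrow> real^'n^'n"
    and t :: "real^'n \<Rightarrow> real^'n \<Rightarrow> real^'n"
    and H :: real
  assumes open_U: "open U"
    and finsler: "finsler_metric U F"
    and riemannian: "riemannian_tensor U a"
    and automorphic: "conformally_automorphic_through U F a H t"
begin

text \<open>With \<open>t\<close> as a function of the pair (x, y), the one derivative
  \<open>DT\<close> holds both t^i_m, its values on \<open>(0, axis m 1)\<close>, and the
  derivatives in x^m, its values on \<open>(axis m 1, 0)\<close>.\<close>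

abbreviation T :: "(real^'n) \<times> (real^'n) \<Rightarrow> real^'n" where
  "T z \<equiv> t (fst z) (snd z)"

abbreviation DT :: "(real^'n) \<times> (real^'n) \<Rightarrow> (real^'n) \<times> (real^'n) \<Rightarrow> real^'n" where
  "DT z \<equiv> frechet_derivative T (at z)"

abbreviation B :: "real^'n \<Rightarrow> real^'n \<Rightarrow> real^'n \<Rightarrow> real" where
  "B x u v \<equiv> u \<bullet> (a x *v v)"

lemma open_slit: "open (slit U)"
  unfolding slit_def by (intro open_Times open_U) (simp add: open_delete)

lemma in_slit [simp]: "(x, y) \<in> slit U \<longleftrightarrow> x \<in> U \<and> y \<noteq> 0"
  by (simp add: slit_def)

lemma H_pos: "H > 0"
  using automorphic by (simp add: conformally_automorphic_through_def)

lemma smooth_T: "smooth_on (slit U) T"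
  using automorphic by (simp add: conformally_automorphic_through_def case_prod_unfold)

lemma smooth_F: "smooth_on (slit U) (\<lambda>z. F (fst z) (snd z))"
  using finsler by (simp add: finsler_metric_def case_prod_unfold)

lemma F_pos: "\<lbrakk>x \<in> U; y \<noteq> 0\<rbrakk> \<Longrightarrow> F x y > 0"
  and F_homogeneous: "\<lbrakk>x \<in> U; y \<noteq> 0; k > 0\<rbrakk> \<Longrightarrow> F x (k *\<^sub>R y) = k * F x y"
  and metric_pos_def: "\<lbrakk>x \<in> U; y \<noteq> 0\<rbrakk> \<Longrightarrow> pos_def (metric_tensor F x y)"
  using finsler by (auto simp: finsler_metric_def)

lemma a_symmetric: "x \<in> U \<Longrightarrow> transpose (a x) = a x"
  and a_pos_def: "x \<in> U \<Longrightarrow> pos_def (a x)"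
  using riemannian by (auto simp: riemannian_tensor_def)

lemma t_bij: "x \<in> U \<Longrightarrow> bij_betw (t x) (UNIV - {0}) (UNIV - {0})"
  and t_homogeneous: "\<lbrakk>x \<in> U; y \<noteq> 0; k > 0\<rbrakk> \<Longrightarrow> t x (k *\<^sub>R y) = (k powr H) *\<^sub>R t x y"
  and indicatrix: "\<lbrakk>x \<in> U; y \<noteq> 0\<rbrakk> \<Longrightarrow> F x y = 1 \<longleftrightarrow> riemannian_function a x (t x y) = 1"
  using automorphic by (auto simp: conformally_automorphic_through_def)

lemma t_nonzero: "\<lbrakk>x \<in> U; y \<noteq> 0\<rbrakk> \<Longrightarrow> t x y \<noteq> 0"
  using bij_betwE[OF t_bij] by auto

lemma B_commute: "x \<in> U \<Longrightarrow> B x u v = B x v u"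
  using symmetric_matrix_inner[OF a_symmetric] by (metis inner_commute)

lemma B_pos: "\<lbrakk>x \<in> U; v \<noteq> 0\<rbrakk> \<Longrightarrow> B x v v > 0"
  using a_pos_def by (simp add: pos_def_iff_inner)

lemma T_has_derivative: "z \<in> slit U \<Longrightarrow> (T has_derivative DT z) (at z)"
  by (rule smooth_on_has_derivative[OF smooth_T])

lemma linear_DT: "z \<in> slit U \<Longrightarrow> linear (DT z)"
  using T_has_derivative has_derivative_linear by blast

lemma linear_DT_snd: "\<lbrakk>x \<in> U; y \<noteq> 0\<rbrakk> \<Longrightarrow> linear (\<lambda>v. DT (x, y) (0, v))"
  by (rule has_derivative_linear[OF has_derivative_partial_snd[OF T_has_derivative]]) simp

lemma component_derivative:
  "\<lbrakk>x \<in> U; y \<noteq> 0\<rbrakk> \<Longrightarrow> ((\<lambda>z. T z $ i) has_derivative (\<lambda>v. DT (x, y) v $ i)) (at (x, y))"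
  by (intro bounded_linear.has_derivative[OF bounded_linear_vec_nth] T_has_derivative) simp

lemma partial_y_t:
  "\<lbrakk>x \<in> U; y \<noteq> 0\<rbrakk> \<Longrightarrow> partial_y k (\<lambda>x y. t x y $ i) x y = DT (x, y) (0, axis k 1) $ i"
  by (rule partial_y_eq[of "\<lambda>x y. t x y $ i"]) (rule component_derivative)

lemma partial_x_t:
  "\<lbrakk>x \<in> U; y \<noteq> 0\<rbrakk> \<Longrightarrow> partial_x k (\<lambda>x y. t x y $ i) x y = DT (x, y) (axis k 1, 0) $ i"
  by (rule partial_x_eq[of "\<lambda>x y. t x y $ i"]) (rule component_derivative)

lemma metric_conformal:
  assumes "x \<in> U" "y \<noteq> 0"
  shows "\<exists>p. \<forall>m n. metric_tensor F x y $ m $ n = p\<^sup>2 * B x (DT (x, y) (0, axis m 1)) (DT (x, y) (0, axis n 1))"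
proof -
  obtain p where p: "\<forall>x\<in>U. \<forall>y. y \<noteq> 0 \<longrightarrow> p x y > 0 \<and>
        (\<forall>m n. metric_tensor F x y $ m $ n =
           (p x y)\<^sup>2 * (\<Sum>i\<in>UNIV. \<Sum>j\<in>UNIV. a x $ i $ j *
              partial_y m (\<lambda>x y. t x y $ i) x y * partial_y n (\<lambda>x y. t x y $ j) x y))"
    using automorphic unfolding conformally_automorphic_through_def by blast
  show ?thesis
    by (rule exI[of _ "p x y"]) (use p assms in \<open>auto simp: partial_y_t quadratic_form_eq_inner\<close>)
qed

text \<open>Bilinear extension of the conformal relation from basis vectors to all vectors. Both
  forms are stated with the same \<open>p\<close>, because \<open>p\<close> is later computed from
  the second with \<open>u = v = y\<close> and inserted into the first.\<close>

lemma metric_form_conformal: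
  assumes "x \<in> U" "y \<noteq> 0"
  shows "\<exists>p. (\<forall>m n. metric_tensor F x y $ m $ n = p\<^sup>2 * B x (DT (x, y) (0, axis m 1)) (DT (x, y) (0, axis n 1))) \<and>
    (\<forall>u v. u \<bullet> (metric_tensor F x y *v v) = p\<^sup>2 * B x (DT (x, y) (0, u)) (DT (x, y) (0, v)))"
proof -
  obtain p where p:
    "\<And>m n. metric_tensor F x y $ m $ n = p\<^sup>2 * B x (DT (x, y) (0, axis m 1)) (DT (x, y) (0, axis n 1))"
    using metric_conformal[OF assms] by blast
  let ?J = "\<lambda>k. DT (x, y) (0, axis k 1)"
  have J: "DT (x, y) (0, v) = (\<Sum>k\<in>UNIV. v $ k *\<^sub>R ?J k)" for v
    using linear_axis_sum[OF linear_DT_snd[OF assms], of v] by simp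
  have "u \<bullet> (metric_tensor F x y *v v) = p\<^sup>2 * B x (DT (x, y) (0, u)) (DT (x, y) (0, v))" for u v
  proof -
    have "u \<bullet> (metric_tensor F x y *v v)
        = (\<Sum>i\<in>UNIV. \<Sum>j\<in>UNIV. p\<^sup>2 * B x (u $ i *\<^sub>R ?J i) (v $ j *\<^sub>R ?J j))"
      unfolding quadratic_form_eq_inner[of "metric_tensor F x y", symmetric]
      by (intro sum.cong refl) (simp add: p matrix_vector_mult_scaleR mult_ac)
    also have "\<dots> = p\<^sup>2 * B x (DT (x, y) (0, u)) (DT (x, y) (0, v))"
      unfolding J[of u] J[of v]
      by (simp only: sum_distrib_left[symmetric] inner_sum_right[symmetric] inner_sum_left[symmetric]
          linear_sum[OF matrix_vector_mul_linear, symmetric])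
    finally show ?thesis .
  qed
  with p show ?thesis by blast
qed

text \<open>By the conformal relation, a kernel vector of the Jacobian of \<open>t x\<close> is a
  null vector of the positive definite metric tensor.\<close>

lemma DT_snd_injective:
  assumes "x \<in> U" "y \<noteq> 0" "DT (x, y) (0, v) = 0"
  shows "v = 0"
proof (rule ccontr)
  assume "v \<noteq> 0"
  then have "v \<bullet> (metric_tensor F x y *v v) > 0"
    using metric_pos_def assms(1,2) by (simp add: pos_def_iff_inner)
  moreover obtain p where
      "\<And>u v. u \<bullet> (metric_tensor F x y *v v) = p\<^sup>2 * B x (DT (x, y) (0, u)) (DT (x, y) (0, v))"
    using metric_form_conformal[OF assms(1,2)] by blast
  ultimately show False using assms(3) by simp
qed

section \<open>Euler relations and the value of the conformal factor\<close>

lemma t_Euler: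
  assumes "x \<in> U" "y \<noteq> 0"
  shows "DT (x, y) (0, y) = H *\<^sub>R t x y"
proof -
  \<comment> \<open>The ray through y is differentiated at k = 1 in two ways: by the chain rule, and
    by homogeneity of \<open>t\<close>, which holds on the open half-line k > 0.\<close>
  have "((\<lambda>k. (x, k *\<^sub>R y)) has_derivative (\<lambda>k. (0, k *\<^sub>R y))) (at 1)"
    by (auto intro!: derivative_eq_intros)
  moreover have "(T has_derivative DT (x, y)) (at (x, 1 *\<^sub>R y))"
    using T_has_derivative[of "(x, y)"] assms by simp
  ultimately have "((\<lambda>k. t x (k *\<^sub>R y)) has_derivative (\<lambda>k. DT (x, y) (0, k *\<^sub>R y))) (at 1)"
    using has_derivative_compose[where g = T and f = "\<lambda>k. (x, k *\<^sub>R y)"] by fastforce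
  moreover have "((\<lambda>k. t x (k *\<^sub>R y)) has_derivative (\<lambda>k. (H * k) *\<^sub>R t x y)) (at 1)"
  proof (rule has_derivative_transform_within_open[where s = "{0<..}"])
    show "((\<lambda>k. (k powr H) *\<^sub>R t x y) has_derivative (\<lambda>k. (H * k) *\<^sub>R t x y)) (at 1)"
      by (auto intro!: derivative_eq_intros simp: mult_ac)
  qed (use assms t_homogeneous in auto)
  ultimately have "(\<lambda>k. DT (x, y) (0, k *\<^sub>R y)) = (\<lambda>k. (H * k) *\<^sub>R t x y)"
    by (rule has_derivative_unique)
  from fun_cong[OF this, of 1] show ?thesis by simp
qed

text \<open>Euler's theorem is used twice on F^2, of degree 2: differentiating along the ray through
  y gives \<open>ray\<close>, and differentiating \<open>ray\<close> at k = 1 gives y^i y^j times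
  the second derivatives of F^2, with value 2 F^2.\<close>

lemma metric_Euler:
  assumes "x \<in> U" "y \<noteq> 0"
  shows "y \<bullet> (metric_tensor F x y *v y) = (F x y)\<^sup>2"
proof -
  let ?f = "\<lambda>y. (F x y)\<^sup>2"
  let ?DF = "\<lambda>z. frechet_derivative (\<lambda>z. F (fst z) (snd z)) (at z)"
  let ?P = "\<lambda>j y. 2 * F x y * ?DF (x, y) (0, axis j 1)"
  have F: "(F x has_derivative (\<lambda>v. ?DF (x, y') (0, v))) (at y')" if "y' \<noteq> 0" for y'
    by (intro has_derivative_partial_snd smooth_on_has_derivative[OF smooth_F]) (use that assms in auto)
  have f: "(?f has_derivative (\<lambda>v. 2 * F x y' * ?DF (x, y') (0, v))) (at y')" if "y' \<noteq> 0" for y'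
    using F[OF that] by (auto intro!: derivative_eq_intros)
  have P: "partial_y j (\<lambda>x y. (F x y)\<^sup>2) x y' = ?P j y'" if "y' \<noteq> 0" for y' j
    unfolding partial_y_def by (rule partial_eq[OF f[OF that]])
  define P' where "P' = (\<lambda>j. frechet_derivative (?P j) (at y))"
  have P': "(?P j has_derivative P' j) (at y)" for j
  proof -
    have "((\<lambda>y. ?DF (x, y) (0, axis j 1)) has_derivative
       (\<lambda>v. frechet_derivative (\<lambda>z. ?DF z (0, axis j 1)) (at (x, y)) (0, v))) (at y)"
      by (intro has_derivative_partial_snd[of "\<lambda>x y. ?DF (x, y) (0, axis j 1)"])
        (use smooth_on_has_derivative[OF smooth_on_frechet_derivative[OF smooth_F]] assms in simp)
    from has_derivative_mult[OF has_derivative_mult_right[OF F[OF assms(2)]] this]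
    have "?P j differentiable (at y)" by (rule differentiableI)
    then show ?thesis unfolding P'_def by (simp only: frechet_derivative_works)
  qed
  have metric: "metric_tensor F x y $ i $ j = 1 / 2 * P' j (axis i 1)" for i j
  proof -
    have "(partial_y j (\<lambda>x y. (F x y)\<^sup>2) x has_derivative P' j) (at y)"
      by (rule has_derivative_transform_within_open[OF P', of "UNIV - {0}"])
         (use P assms in \<open>auto simp: open_delete\<close>)
    from partial_eq[OF this, of i] show ?thesis
      by (simp add: metric_tensor_def partial_y_def)
  qed
  \<comment> \<open>The identity is needed for all k > 0, not only at k = 1, since it is
    differentiated in k next.\<close>
  have ray: "(\<Sum>j\<in>UNIV. y $ j * ?P j (k *\<^sub>R y)) = 2 * k * (F x y)\<^sup>2" if "k > 0" for k
  proof -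
    have ky: "k *\<^sub>R y \<noteq> 0" using that assms by simp
    have "((\<lambda>k. ?f (0 + k *\<^sub>R y)) has_real_derivative 2 * F x (k *\<^sub>R y) * ?DF (x, k *\<^sub>R y) (0, y)) (at k)"
      by (rule has_derivative_imp_line) (use f[OF ky] in simp)
    moreover have "((\<lambda>k. ?f (0 + k *\<^sub>R y)) has_real_derivative 2 * k * (F x y)\<^sup>2) (at k)"
    proof (rule DERIV_cong_ev[THEN iffD1, OF refl _ refl])
      show "((\<lambda>k. k\<^sup>2 * (F x y)\<^sup>2) has_real_derivative 2 * k * (F x y)\<^sup>2) (at k)"
        by (auto intro!: derivative_eq_intros)
      show "eventually (\<lambda>k. k\<^sup>2 * (F x y)\<^sup>2 = ?f (0 + k *\<^sub>R y)) (nhds k)"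
        using eventually_nhds_in_open[of "{0<..}" k] that
        by (auto elim!: eventually_mono simp: F_homogeneous assms power_mult_distrib)
    qed
    ultimately have "2 * F x (k *\<^sub>R y) * ?DF (x, k *\<^sub>R y) (0, y) = 2 * k * (F x y)\<^sup>2"
      by (rule DERIV_unique)
    moreover have "(\<Sum>j\<in>UNIV. y $ j *\<^sub>R ?P j (k *\<^sub>R y)) = 2 * F x (k *\<^sub>R y) * ?DF (x, k *\<^sub>R y) (0, y)"
      by (rule linear_axis_sum[OF has_derivative_linear[OF f[OF ky]]])
    ultimately show ?thesis by simp
  qed
  have ray': "((\<lambda>k. \<Sum>j\<in>UNIV. y $ j * ?P j (k *\<^sub>R y)) has_real_derivative (\<Sum>j\<in>UNIV. y $ j * P' j y)) (at 1)"
  proof (intro DERIV_sum DERIV_cmult)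
    fix j show "((\<lambda>k. ?P j (k *\<^sub>R y)) has_real_derivative P' j y) (at 1)"
      using has_derivative_imp_line[of "?P j" "P' j" 0 1 y] P' by simp
  qed
  have "((\<lambda>k. 2 * k * (F x y)\<^sup>2) has_real_derivative (\<Sum>j\<in>UNIV. y $ j * P' j y)) (at 1)"
    by (rule has_field_derivative_transform_within_open[OF ray', of "{0<..}"]) (simp_all add: ray)
  moreover have "((\<lambda>k. 2 * k * (F x y)\<^sup>2) has_real_derivative 2 * (F x y)\<^sup>2) (at 1)"
    by (auto intro!: derivative_eq_intros)
  ultimately have "(\<Sum>j\<in>UNIV. y $ j * P' j y) = 2 * (F x y)\<^sup>2" by (rule DERIV_unique)
  moreover have "P' j y = (\<Sum>i\<in>UNIV. y $ i * P' j (axis i 1))" for j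
    using linear_axis_sum[OF has_derivative_linear[OF P'], of y] by simp
  ultimately have "(\<Sum>j\<in>UNIV. \<Sum>i\<in>UNIV. y $ j * (y $ i * P' j (axis i 1))) = 2 * (F x y)\<^sup>2"
    by (simp add: sum_distrib_left)
  moreover have "y \<bullet> (metric_tensor F x y *v y)
      = (\<Sum>j\<in>UNIV. \<Sum>i\<in>UNIV. 1 / 2 * (y $ j * (y $ i * P' j (axis i 1))))"
    unfolding quadratic_form_eq_inner[of "metric_tensor F x y", symmetric]
    by (subst sum.swap) (simp add: metric mult_ac)
  ultimately show ?thesis by (simp only: sum_distrib_left[symmetric])
qed

text \<open>Dividing y by F(x, y) moves it onto the indicatrix, where b = 1 by the correspondence of
  indicatrices; homogeneity of \<open>t\<close> scales this back to b = F^(2H).\<close>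

lemma F_squared_eq:
  assumes "x \<in> U" "y \<noteq> 0"
  shows "(F x y)\<^sup>2 = B x (t x y) (t x y) powr (1 / H)"
proof -
  let ?c = "1 / F x y"
  have c: "?c > 0" "F x y > 0" using F_pos[OF assms] by auto
  have "F x (?c *\<^sub>R y) = 1" using F_homogeneous[OF assms c(1)] c by simp
  then have "riemannian_function a x (t x (?c *\<^sub>R y)) = 1"
    using indicatrix[of x "?c *\<^sub>R y"] assms c by simp
  then have "B x (t x (?c *\<^sub>R y)) (t x (?c *\<^sub>R y)) = 1"
    by (simp add: riemannian_function_def quadratic_form_eq_inner)
  then have "(?c powr H)\<^sup>2 * B x (t x y) (t x y) = 1"
    by (simp add: t_homogeneous[OF assms c(1)] matrix_vector_mult_scaleR power2_eq_square mult_ac)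
  then have "B x (t x y) (t x y) = (F x y powr H)\<^sup>2"
    using c by (simp add: powr_divide field_simps)
  also have "\<dots> = F x y powr (2 * H)"
    using powr_add[of "F x y" H H] by (simp add: power2_eq_square)
  finally show ?thesis using c H_pos by (simp add: powr_powr)
qed

text \<open>Contracting twice with y gives F^2 = p^2 H^2 b by the Euler relations, and F^2 = b^(1/H)
  then determines p^2.\<close>

lemma metric_tensor_eq:
  assumes "x \<in> U" "y \<noteq> 0"
  shows "metric_tensor F x y $ m $ n = B x (t x y) (t x y) powr (1 / H - 1) / H\<^sup>2 *
           B x (DT (x, y) (0, axis m 1)) (DT (x, y) (0, axis n 1))"
proof -
  let ?b = "B x (t x y) (t x y)"
  obtain p where p:
    "\<And>m n. metric_tensor F x y $ m $ n = p\<^sup>2 * B x (DT (x, y) (0, axis m 1)) (DT (x, y) (0, axis n 1))"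
    "\<And>u v. u \<bullet> (metric_tensor F x y *v v) = p\<^sup>2 * B x (DT (x, y) (0, u)) (DT (x, y) (0, v))"
    using metric_form_conformal[OF assms] by blast
  have b: "?b > 0" using B_pos t_nonzero assms by simp
  have "?b powr (1 / H) = p\<^sup>2 * (H\<^sup>2 * ?b)"
    using p(2)[of y y] metric_Euler[OF assms] F_squared_eq[OF assms] t_Euler[OF assms]
    by (simp add: matrix_vector_mult_scaleR power2_eq_square mult_ac)
  moreover have "?b powr (1 / H - 1) = ?b powr (1 / H) / ?b"
    using b by (simp add: powr_diff)
  ultimately have "p\<^sup>2 = ?b powr (1 / H - 1) / H\<^sup>2"
    using b H_pos by simp
  with p(1) show ?thesis by simp
qed

subsection \<open>The connection and the covariant derivative\<close>

text \<open>The identity d_m t^i = - a^i_hm t^h. The vector N_m is minus the inverse Jacobian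
  applied to the bracket \<open>?w\<close>, so applying the Jacobian to it cancels the x-derivative
  of \<open>t\<close> and leaves the Christoffel term.\<close>

lemma connection_horizontal:
  assumes "x \<in> U" "y \<noteq> 0"
  shows "DT (x, y) (axis m 1, \<chi> k. connection_coeff a t k m x y) = - (christoffel_matrix a x m *v t x y)"
proof -
  let ?L = "\<lambda>v. DT (x, y) (0, v)"
  have lin: "linear ?L" by (rule linear_DT_snd[OF assms])
  have "inj ?L" using DT_snd_injective[OF assms] lin by (simp add: linear_injective_0)
  then obtain g where g: "linear g" "\<And>v. ?L (g v) = v"
    using linear_injective_isomorphism[OF lin] by blast
  have "(inverse_transformation t x has_derivative g) (at (t x y))"
  \<comment> \<open>Inverse function theorem: \<open>t x\<close> is continuous with left inverse
    \<open>inverse_transformation t x\<close> on nonzero vectors, and its derivative at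
    \<open>y\<close> has the inverse \<open>g\<close>.\<close>
  proof (rule has_derivative_inverse_strong[where S = "UNIV - {0}" and f = "t x" and x = y])
    have D: "(t x has_derivative (\<lambda>v. DT (x, y') (0, v))) (at y')" if "y' \<noteq> 0" for y'
      by (rule has_derivative_partial_snd[OF T_has_derivative]) (use assms that in simp)
    then show "(t x has_derivative ?L) (at y)" using assms by simp
    show "continuous_on (UNIV - {0}) (t x)"
      using D by (intro differentiable_imp_continuous_on)
        (auto simp: differentiable_on_def differentiable_def intro: has_derivative_at_withinI)
    show "inverse_transformation t x (t x y') = y'" if "y' \<in> UNIV - {0}" for y'
      using t_bij[OF assms(1)] that
      by (simp add: inverse_transformation_def bij_betw_def inv_into_f_f)
  qed (use assms g in \<open>auto simp: open_delete fun_eq_iff\<close>)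
  then have inv: "partial i (\<lambda>s. inverse_transformation t x s $ k) (t x y) = g (axis i 1) $ k" for i k
    by (intro partial_eq bounded_linear.has_derivative[OF bounded_linear_vec_nth])
  let ?w = "DT (x, y) (axis m 1, 0) + christoffel_matrix a x m *v t x y"
  have "(\<chi> k. connection_coeff a t k m x y) = - (\<Sum>i\<in>UNIV. ?w $ i *\<^sub>R g (axis i 1))"
    by (simp add: vec_eq_iff connection_coeff_def inv partial_x_t[OF assms] christoffel_matrix_def
        matrix_vector_mult_def mult_ac)
  also have "\<dots> = - g ?w" by (simp only: linear_axis_sum[OF g(1)])
  finally have N: "(\<chi> k. connection_coeff a t k m x y) = - g ?w" .
  have "DT (x, y) (axis m 1, - g ?w) = DT (x, y) (axis m 1, 0) + ?L (- g ?w)"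
    using linear_add[OF linear_DT, of "(x, y)" "(axis m 1, 0)" "(0, - g ?w)"] assms by simp
  also have "?L (- g ?w) = - ?w" using linear_neg[OF lin] g(2) by simp
  finally show ?thesis by (simp add: N)
qed

section \<open>Horizontal derivative of the Jacobian of t\<close>

abbreviation D2T :: "(real^'n) \<times> (real^'n) \<Rightarrow> (real^'n) \<times> (real^'n) \<Rightarrow> (real^'n) \<times> (real^'n) \<Rightarrow> real^'n" where
  "D2T z v \<equiv> frechet_derivative (\<lambda>z. DT z v) (at z)"

lemma DT_has_derivative: "z \<in> slit U \<Longrightarrow> ((\<lambda>z. DT z v) has_derivative D2T z v) (at z)"
  by (rule smooth_on_has_derivative[OF smooth_on_frechet_derivative[OF smooth_T]])

lemma D2T_commute: "z \<in> slit U \<Longrightarrow> D2T z v w = D2T z w v"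
  by (rule smooth_on_mixed_derivatives_eq[OF open_slit _ smooth_T])

text \<open>By \<open>connection_horizontal\<close>, N_m solves at every nonzero y a linear system
  whose matrix is the nonsingular Jacobian of \<open>t x\<close>; matrix and right-hand side are
  differentiable in y because \<open>t\<close> is smooth.\<close>

lemma connection_differentiable:
  assumes "x \<in> U" "y \<noteq> 0"
  shows "connection_coeff a t k m x differentiable (at y)"
proof -
  let ?L = "\<lambda>y v. DT (x, y) (0, v)"
  let ?b = "\<lambda>y. - (christoffel_matrix a x m *v t x y) - DT (x, y) (axis m 1, 0)"
  let ?N = "\<lambda>y. \<chi> k. connection_coeff a t k m x y"
  have T: "(t x has_derivative (\<lambda>v. DT (x, y) (0, v))) (at y)"
    by (rule has_derivative_partial_snd[OF T_has_derivative]) (use assms in simp)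
  have DT: "((\<lambda>y. DT (x, y) w) has_derivative (\<lambda>v. D2T (x, y) w (0, v))) (at y)" for w
    by (rule has_derivative_partial_snd[of "\<lambda>x y. DT (x, y) w"])
       (use DT_has_derivative[of "(x, y)" w] assms in simp)
  have "(\<lambda>y. ?N y $ k) differentiable (at y)"
  proof (rule differentiable_linear_system[of "\<lambda>y. matrix (?L y)" y ?b "UNIV - {0}" ?N])
    have "(\<lambda>y. DT (x, y) w $ i) differentiable (at y)" for w i
      by (rule differentiableI[OF bounded_linear.has_derivative[OF bounded_linear_vec_nth DT]])
    then show "(\<lambda>y. matrix (?L y) $ i $ l) differentiable (at y)" for i l
      by (simp add: matrix_def)
    have "((\<lambda>y. ?b y $ i) has_derivative
        (\<lambda>v. (- (christoffel_matrix a x m *v DT (x, y) (0, v)) - D2T (x, y) (axis m 1, 0) (0, v)) $ i)) (at y)" for i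
      by (intro bounded_linear.has_derivative[OF bounded_linear_vec_nth] has_derivative_diff DT
          has_derivative_minus bounded_linear.has_derivative[OF matrix_vector_mul_bounded_linear] T)
    then show "(\<lambda>y. ?b y $ i) differentiable (at y)" for i
      by (rule differentiableI)
    fix y' :: "real^'n" assume "y' \<in> UNIV - {0}"
    then have y': "y' \<noteq> 0" by simp
    note lin = linear_DT_snd[OF assms(1) y']
    show "det (matrix (?L y')) \<noteq> 0"
      using DT_snd_injective[OF assms(1) y'] lin by (simp add: det_nz_iff_inj linear_injective_0)
    have "DT (x, y') (axis m 1, ?N y') = DT (x, y') (axis m 1, 0) + ?L y' (?N y')"
      using linear_add[OF linear_DT, of "(x, y')" "(axis m 1, 0)" "(0, ?N y')"] assms y' by simp
    then have "?L y' (?N y') = ?b y'"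
      unfolding connection_horizontal[OF assms(1) y'] by (simp add: algebra_simps)
    then show "matrix (?L y') *v ?N y' = ?b y'"
      by (simp only: matrix_works[OF lin[folded linear_matrix_vector_mul_eq]])
  qed (use assms in \<open>simp_all add: open_delete\<close>)
  then show ?thesis by simp
qed

lemma horizontal_D2T:
  assumes "x \<in> U" "y \<noteq> 0"
  shows "D2T (x, y) (0, axis n 1) (axis m 1, \<chi> k. connection_coeff a t k m x y)
    = - (christoffel_matrix a x m *v DT (x, y) (0, axis n 1))
      - (\<Sum>k\<in>UNIV. partial_y n (connection_coeff a t k m) x y *\<^sub>R DT (x, y) (0, axis k 1))"
proof -
  let ?N = "\<lambda>k y. connection_coeff a t k m x y"
  let ?z = "(x, y)" and ?e = "axis n 1 :: real^'n" and ?G = "christoffel_matrix a x m"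
  have z: "?z \<in> slit U" using assms by simp
  define N' where "N' k = frechet_derivative (?N k) (at y)" for k
  have N': "(?N k has_derivative N' k) (at y)" for k
    using connection_differentiable[OF assms, of k m] by (simp add: N'_def frechet_derivative_works)
  have P: "partial_y n (connection_coeff a t k m) x y = N' k ?e" for k
    unfolding partial_y_def by (rule partial_eq[OF N'])
  have DT: "((\<lambda>y. DT (x, y) w) has_derivative (\<lambda>v. D2T ?z w (0, v))) (at y)" for w
    by (rule has_derivative_partial_snd[of "\<lambda>x y. DT (x, y) w"])
       (use DT_has_derivative[OF z, of w] in simp)
  \<comment> \<open>This is d_m t written out with x fixed. It is differentiated once by the product
    rule and once through \<open>connection_horizontal\<close>; uniqueness of the derivative equates
    the results.\<close>
  let ?lhs = "\<lambda>y. DT (x, y) (axis m 1, 0) + (\<Sum>k\<in>UNIV. ?N k y *\<^sub>R DT (x, y) (0, axis k 1))"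
  have "(?lhs has_derivative (\<lambda>v. D2T ?z (axis m 1, 0) (0, v) + (\<Sum>k\<in>UNIV.
      ?N k y *\<^sub>R D2T ?z (0, axis k 1) (0, v) + N' k v *\<^sub>R DT ?z (0, axis k 1)))) (at y)"
    by (intro has_derivative_add DT has_derivative_sum has_derivative_scaleR N')
  moreover have "(?lhs has_derivative (\<lambda>v. - (?G *v DT ?z (0, v)))) (at y)"
  proof (rule has_derivative_transform_within_open[where s = "UNIV - {0}"])
    have T: "(t x has_derivative (\<lambda>v. DT ?z (0, v))) (at y)"
      by (rule has_derivative_partial_snd[OF T_has_derivative[OF z]])
    then show "((\<lambda>y. - (?G *v t x y)) has_derivative (\<lambda>v. - (?G *v DT ?z (0, v)))) (at y)"
      by (intro has_derivative_minus bounded_linear.has_derivative[OF matrix_vector_mul_bounded_linear])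
    fix y' :: "real^'n" assume "y' \<in> UNIV - {0}"
    then have y': "y' \<noteq> 0" by simp
    have "DT (x, y') (axis m 1, \<chi> k. ?N k y') = ?lhs y'"
      using linear_add[OF linear_DT, of "(x, y')" "(axis m 1, 0)" "(0, \<chi> k. ?N k y')"] assms y'
        linear_axis_sum[OF linear_DT_snd[OF assms(1) y'], of "\<chi> k. ?N k y'"] by simp
    then show "- (?G *v t x y') = ?lhs y'"
      by (simp only: connection_horizontal[OF assms(1) y'])
  qed (use assms in \<open>simp_all add: open_delete\<close>)
  ultimately have "(\<lambda>v. D2T ?z (axis m 1, 0) (0, v) + (\<Sum>k\<in>UNIV.
      ?N k y *\<^sub>R D2T ?z (0, axis k 1) (0, v) + N' k v *\<^sub>R DT ?z (0, axis k 1)))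
    = (\<lambda>v. - (?G *v DT ?z (0, v)))"
    by (rule has_derivative_unique)
  from fun_cong[OF this, of ?e]
  \<comment> \<open>Symmetry of second derivatives turns derivatives along y^n of components of the
    derivative of \<open>t\<close> into derivatives of t_n; with the N terms these combine to d_m
    t_n.\<close>
  have eq: "D2T ?z (0, ?e) (axis m 1, 0) + (\<Sum>k\<in>UNIV. ?N k y *\<^sub>R D2T ?z (0, ?e) (0, axis k 1))
     + (\<Sum>k\<in>UNIV. N' k ?e *\<^sub>R DT ?z (0, axis k 1)) = - (?G *v DT ?z (0, ?e))"
    by (simp add: sum.distrib D2T_commute[OF z, of _ "(0, ?e)"] add.assoc)
  note D2 = DT_has_derivative[OF z, of "(0, ?e)"]
  have "linear (\<lambda>v. D2T ?z (0, ?e) (0, v))"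
    by (rule has_derivative_linear[OF DT])
  from linear_axis_sum[OF this, of "\<chi> k. ?N k y"]
  have "D2T ?z (0, ?e) (axis m 1, \<chi> k. ?N k y)
      = D2T ?z (0, ?e) (axis m 1, 0) + (\<Sum>k\<in>UNIV. ?N k y *\<^sub>R D2T ?z (0, ?e) (0, axis k 1))"
    using linear_add[OF has_derivative_linear[OF D2], of "(axis m 1, 0)" "(0, \<chi> k. ?N k y)"] by simp
  with eq show ?thesis by (simp add: P eq_diff_eq)
qed

lemma covariant_deriv_metric_tensor:
  assumes "x \<in> U" "y \<noteq> 0"
  shows "covariant_deriv (connection_coeff a t) m (metric_tensor F) n j x y = 0"
proof -
  let ?z = "(x, y)" and ?G = "christoffel_matrix a x m" and ?J = "\<lambda>k z. DT z (0, axis k 1)"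
  let ?E = "(axis m 1, \<chi> k. connection_coeff a t k m x y)"
  let ?P = "\<lambda>n k. partial_y n (connection_coeff a t k m) x y"
  let ?b = "\<lambda>z. B (fst z) (T z) (T z)"
  \<comment> \<open>The squared conformal factor found in \<open>metric_tensor_eq\<close>.\<close>
  let ?q = "\<lambda>z. ?b z powr (1 / H - 1) / H\<^sup>2"
  let ?B = "\<lambda>z. B (fst z) (?J n z) (?J j z)"
  have z: "?z \<in> slit U" using assms by simp
  define a' where "a' = frechet_derivative a (at x)"
  have a': "(a has_derivative a') (at x)"
    unfolding a'_def by (rule smooth_on_has_derivative) (use riemannian assms in \<open>auto simp: riemannian_tensor_def\<close>)
  have compat: "u \<bullet> (a' (axis m 1) *v v) = B x (?G *v u) v + B x u (?G *v v)" for u v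
    by (rule christoffel_metric_compatible[OF open_U assms(1) riemannian a'])
  have a_fst: "((\<lambda>z. a (fst z)) has_derivative (\<lambda>h. a' (fst h))) (at ?z)"
    by (rule has_derivative_compose[OF has_derivative_fst[OF has_derivative_ident]]) (use a' in simp)
  define b' where "b' = (\<lambda>h. DT ?z h \<bullet> (a x *v t x y) + t x y \<bullet> (a' (fst h) *v t x y)
    + t x y \<bullet> (a x *v DT ?z h))"
  have b': "(?b has_derivative b') (at ?z)"
    using has_derivative_inner_matrix[OF T_has_derivative[OF z] a_fst T_has_derivative[OF z]]
    by (simp add: b'_def)
  \<comment> \<open>Along the horizontal vector \<open>?E\<close>, the two terms from d_m t cancel
    the derivative of \<open>a\<close> by metric compatibility.\<close>
  have "b' ?E = 0"
    by (simp add: b'_def connection_horizontal[OF assms] compat linear_neg[OF matrix_vector_mul_linear])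
  have "?b ?z > 0" using B_pos t_nonzero assms by simp
  define q' where "q' = (\<lambda>h. (1 / H - 1) * ?b ?z powr (1 / H - 1 - 1) * b' h / H\<^sup>2)"
  have q': "(?q has_derivative q') (at ?z)"
  proof -
    have "((\<lambda>s. s powr (1 / H - 1) / H\<^sup>2) has_real_derivative
        (1 / H - 1) * ?b ?z powr (1 / H - 1 - 1) / H\<^sup>2) (at (?b ?z))"
      by (intro DERIV_cdivide has_real_derivative_powr \<open>?b ?z > 0\<close>)
    from has_derivative_compose[OF b' this[unfolded has_field_derivative_def]]
    show ?thesis by (simp add: q'_def)
  qed
  have "q' ?E = 0" by (simp add: q'_def \<open>b' ?E = 0\<close>)
  define B' where "B' = (\<lambda>h. D2T ?z (0, axis n 1) h \<bullet> (a x *v ?J j ?z) + ?J n ?z \<bullet> (a' (fst h) *v ?J j ?z)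
    + ?J n ?z \<bullet> (a x *v D2T ?z (0, axis j 1) h))"
  have B': "(?B has_derivative B') (at ?z)"
    using has_derivative_inner_matrix[OF DT_has_derivative[OF z] a_fst DT_has_derivative[OF z]]
    by (simp add: B'_def)
  \<comment> \<open>The Christoffel terms cancel as for b. What remains are the terms with
    y-derivatives of N, which, after multiplication by \<open>?q\<close>, are the negatives of the
    two correction sums in the covariant derivative.\<close>
  have "B' ?E = - (\<Sum>k\<in>UNIV. ?P n k * B x (?J k ?z) (?J j ?z)) - (\<Sum>k\<in>UNIV. ?P j k * B x (?J k ?z) (?J n ?z))"
    by (simp add: B'_def horizontal_D2T[OF assms] compat inner_diff_left inner_sum_left
        matrix_vector_mult_diff_distrib linear_neg[OF matrix_vector_mul_linear] inner_diff_right
        linear_sum[OF matrix_vector_mul_linear] inner_sum_right matrix_vector_mult_scaleR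
        B_commute[OF assms(1), of "?J n ?z"])
  have g: "metric_tensor F x y $ k $ l = ?q ?z * B x (?J k ?z) (?J l ?z)" for k l
    using metric_tensor_eq[OF assms] by simp
  have "((\<lambda>z. metric_tensor F (fst z) (snd z) $ n $ j) has_derivative
     (\<lambda>h. ?q ?z * B' h + q' h * ?B ?z)) (at ?z)"
  \<comment> \<open>The formula for the metric tensor holds on the whole open slit bundle, so it may
    be differentiated in x as well as in y.\<close>
  proof (rule has_derivative_transform_within_open[OF has_derivative_mult[OF q' B'] open_slit z])
    fix w assume "w \<in> slit U"
    then show "?q w * ?B w = metric_tensor F (fst w) (snd w) $ n $ j"
      using metric_tensor_eq[of "fst w" "snd w" n j] by (simp add: slit_def mem_Times_iff)
  qed
  from horizontal_deriv_eq[of "\<lambda>x y. metric_tensor F x y $ n $ j", OF this, of "connection_coeff a t" m]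
  have "horizontal_deriv (connection_coeff a t) m (\<lambda>x y. metric_tensor F x y $ n $ j) x y = ?q ?z * B' ?E"
    by (simp add: \<open>q' ?E = 0\<close>)
  moreover have "(\<Sum>k\<in>UNIV. ?P l k * metric_tensor F x y $ k $ i)
      = ?q ?z * (\<Sum>k\<in>UNIV. ?P l k * B x (?J k ?z) (?J i ?z))" for l i
    unfolding sum_distrib_left g by (intro sum.cong refl) (simp only: mult_ac)
  ultimately show ?thesis
    unfolding covariant_deriv_def \<open>B' ?E = _\<close> by (simp only: right_diff_distrib minus_mult_right[symmetric])
qed

end

theorem mainTheorem7:
  fixes U :: "(real^'n::finite) set"
    and F :: "real^'n \<Rightarrow> real^'n \<Rightarrow> real"
    and a :: "real^'n \<Rightarrow> real^'n^'n"
    and t :: "real^'n \<Rightarrow> real^'n \<Rightarrow> real^'n"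
    and H :: real
    and x y :: "real^'n"
    and m n j :: 'n
  assumes "CARD('n) \<ge> 3"
    and "open U"
    and "finsler_metric U F"
    and "riemannian_tensor U a"
    and "conformally_automorphic_through U F a H t"
    and "x \<in> U" and "y \<noteq> 0"
  shows "covariant_deriv (connection_coeff a t) m (metric_tensor F) n j x y = 0"
proof -
  interpret conformal_automorphism U F a t H
    using assms by unfold_locales
  show ?thesis using assms by (intro covariant_deriv_metric_tensor)
qed

end
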